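(* Let $B\ge 1$, let $x_{\rm tr}\in\mathbb{C}^B\setminus\{0\}$ be a fixed training vector, let $\sigma_x^2,\sigma_w^2>0$, and let $h\in\mathbb{C}\setminus\{0\}$ be a deterministic channel coefficient. Every filter $f\in\mathbb{C}^B\setminus\{0\}$ that minimizes $\left[\mathrm{MSE}_x^{dc}(\mathrm{ZF})\right]_0$ over $\mathbb{C}^B\setminus\{0\}$ satisfies $$f^Hx_{\rm tr}=1+\frac{\sigma_w^2}{\sigma_x^2|h|^2}.$$ Moreover, the filter $$f_{\rm opt}^{dc\mathrm{ZF}}=\left(1+\frac{\sigma_w^2}{\sigma_x^2|h|^2}\right)\frac{x_{\rm tr}}{\|x_{\rm tr}\|^2}$$ satisfies this condition and is an optimal channel estimator for (i.e., a minimizer of) $\left[\mathrm{MSE}_x^{dc}(\mathrm{ZF})\right]_0$.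
   Context: Training model: $y_{\rm tr}=h\,x_{\rm tr}+w_{\rm tr}$, where $w_{\rm tr}\in\mathbb{C}^B$ has i.i.d. circularly symmetric complex Gaussian entries of mean $0$ and variance $\sigma_w^2$. A linear channel estimator is determined by a filter $f\in\mathbb{C}^B$ through $\hat h=f^H y_{\rm tr}$. The data symbols have mean zero and power $\sigma_x^2$. The zeroth order symbol estimate MSE of the zero-forcing equalizer for a deterministic channel is defined as $$\left[\mathrm{MSE}_x^{dc}(\mathrm{ZF})\right]_0(f)=\frac{E[|\hat h-h|^2]}{E[|\hat h|^2]}\,\sigma_x^2+\frac{\sigma_w^2}{E[|\hat h|^2]} =\sigma_x^2\,\frac{|h|^2|f^Hx_{\rm tr}-1|^2+\sigma_w^2\|f\|^2+\sigma_w^2/\sigma_x^2}{|h|^2|f^Hx_{\rm tr}|^2+\sigma_w^2\|f\|^2},$$ with expectations over $w_{\rm tr}$ ($h$ is fixed). *)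

theory Defs
  imports "HOL-Probability.Probability"
begin

definition herm_prod :: "complex ^ 'n \<Rightarrow> complex ^ 'n \<Rightarrow> complex"
  where "herm_prod f y = (\<Sum>i\<in>UNIV. cnj (f $ i) * y $ i)"

text \<open>Circular symmetry of a zero-mean complex Gaussian of variance \<open>v\<close> means that its real and
  imaginary parts are independent, each Gaussian with mean 0 and variance \<open>v / 2\<close>. The second
  parameter of \<^const>\<open>normal_density\<close> is the standard deviation.\<close>

definition circ_complex_gaussian :: "'a measure \<Rightarrow> ('a \<Rightarrow> complex) \<Rightarrow> real \<Rightarrow> bool"
  where "circ_complex_gaussian M Z v \<longleftrightarrow>
    prob_space.indep_var M borel (\<lambda>\<omega>. Re (Z \<omega>)) borel (\<lambda>\<omega>. Im (Z \<omega>)) \<and>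
    distributed M lborel (\<lambda>\<omega>. Re (Z \<omega>)) (normal_density 0 (sqrt (v / 2))) \<and>
    distributed M lborel (\<lambda>\<omega>. Im (Z \<omega>)) (normal_density 0 (sqrt (v / 2)))"

definition iid_circ_complex_gaussian :: "'a measure \<Rightarrow> ('a \<Rightarrow> complex ^ 'n) \<Rightarrow> real \<Rightarrow> bool"
  where "iid_circ_complex_gaussian M W v \<longleftrightarrow>
    prob_space.indep_vars M (\<lambda>_. borel) (\<lambda>i \<omega>. W \<omega> $ i) UNIV \<and>
    (\<forall>i. circ_complex_gaussian M (\<lambda>\<omega>. W \<omega> $ i) v)"

definition training_output :: "complex \<Rightarrow> complex ^ 'n \<Rightarrow> ('a \<Rightarrow> complex ^ 'n) \<Rightarrow> 'a \<Rightarrow> complex ^ 'n"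
  where "training_output h x W \<omega> = h *s x + W \<omega>"

definition channel_estimate ::
    "complex \<Rightarrow> complex ^ 'n \<Rightarrow> ('a \<Rightarrow> complex ^ 'n) \<Rightarrow> complex ^ 'n \<Rightarrow> 'a \<Rightarrow> complex"
  where "channel_estimate h x W f \<omega> = herm_prod f (training_output h x W \<omega>)"

text \<open>The parameters \<open>\<sigma>x\<close> and \<open>\<sigma>w\<close> are standard deviations, so \<open>\<sigma>x\<^sup>2\<close> is the symbol power and
  \<open>\<sigma>w\<^sup>2\<close> the noise variance.\<close>

definition mse_dc_zf_0 ::
    "'a measure \<Rightarrow> ('a \<Rightarrow> complex ^ 'n) \<Rightarrow> real \<Rightarrow> real \<Rightarrow> complex \<Rightarrow> complex ^ 'n \<Rightarrow> complex ^ 'n \<Rightarrow> real"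
  where "mse_dc_zf_0 M W \<sigma>x \<sigma>w h x f =
    prob_space.expectation M (\<lambda>\<omega>. (cmod (channel_estimate h x W f \<omega> - h))\<^sup>2)
      / prob_space.expectation M (\<lambda>\<omega>. (cmod (channel_estimate h x W f \<omega>))\<^sup>2) * \<sigma>x\<^sup>2
    + \<sigma>w\<^sup>2 / prob_space.expectation M (\<lambda>\<omega>. (cmod (channel_estimate h x W f \<omega>))\<^sup>2)"

definition f_opt_dc_zf :: "real \<Rightarrow> real \<Rightarrow> complex \<Rightarrow> complex ^ 'n \<Rightarrow> complex ^ 'n"
  where "f_opt_dc_zf \<sigma>x \<sigma>w h x =
    (1 + \<sigma>w\<^sup>2 / (\<sigma>x\<^sup>2 * (cmod h)\<^sup>2)) *\<^sub>R ((1 / (norm x)\<^sup>2) *\<^sub>R x)"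

end

(* Writing p = herm_prod f x, a = (cmod h)^2 and c = 1 + \<sigma>w^2 / (\<sigma>x^2 a), the noise moments give
     MSE f = \<sigma>x^2 (1 + a (c - 2 Re p) / D),   D = a (cmod p)^2 + \<sigma>w^2 (norm f)^2.
   By Cauchy-Schwarz D \<ge> K (cmod p)^2 with K = a + \<sigma>w^2 / (norm x)^2, with equality when f is parallel
   to x. Completing the square, K c (c - 2 Re p) + D \<ge> K (cmod (p - c))^2, so (c - 2 Re p) / D is at
   least - 1 / (K c), strictly unless p = c. *)
theory Submission
  imports Defs
begin

lemma herm_prod_add_right: "herm_prod f (y + z) = herm_prod f y + herm_prod f z"
  by (simp add: herm_prod_def algebra_simps sum.distrib)

lemma herm_prod_mult_right: "herm_prod f (c *s y) = c * herm_prod f y"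
  by (simp add: herm_prod_def sum_distrib_left mult_ac)

lemma herm_prod_scaleR_left: "herm_prod (r *\<^sub>R f) y = of_real r * herm_prod f y"
  by (simp add: herm_prod_def sum_distrib_left mult_ac scaleR_conv_of_real[where 'a = complex])

lemma norm_vec_power2: "(norm f)\<^sup>2 = (\<Sum>i\<in>UNIV. (norm (f $ i))\<^sup>2)"
  by (simp add: norm_vec_def L2_set_def sum_nonneg)

lemma herm_prod_self: "herm_prod f f = of_real ((norm f)\<^sup>2)"
proof -
  have "cnj z * z = of_real ((cmod z)\<^sup>2)" for z
    by (metis complex_norm_square mult.commute of_real_power)
  then show ?thesis
    by (simp only: herm_prod_def norm_vec_power2 of_real_sum)
qed

text \<open>Cauchy-Schwarz: the triangle inequality passes to the moduli of the entries, and the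
  real inequality for \<open>L2_set\<close> does the rest. The \<open>inner\<close> of
  \<open>complex ^ 'n\<close> is only the real part of \<open>herm_prod\<close>, so its own
  inequality would not bound the modulus.\<close>

lemma cmod_herm_prod_le: "cmod (herm_prod f y) \<le> norm f * norm y"
proof -
  have "cmod (herm_prod f y) \<le> (\<Sum>i\<in>UNIV. \<bar>norm (f $ i)\<bar> * \<bar>norm (y $ i)\<bar>)"
    unfolding herm_prod_def by (rule order_trans[OF norm_sum]) (simp add: norm_mult)
  also have "\<dots> \<le> norm f * norm y"
    unfolding norm_vec_def by (rule L2_set_mult_ineq)
  finally show ?thesis .
qed

context prob_space
begin

lemma normal_distributed_second_moment:
  assumes "0 < \<sigma>" and D: "distributed M lborel X (normal_density 0 \<sigma>)"
  shows "integrable M X" "expectation X = 0"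
    "integrable M (\<lambda>\<omega>. (X \<omega>)\<^sup>2)" "expectation (\<lambda>\<omega>. (X \<omega>)\<^sup>2) = \<sigma>\<^sup>2"
proof -
  show "integrable M X"
    using integrable_normal_moment_nz_1[OF assms(1), of 0]
    by (subst distributed_integrable[OF D, of "\<lambda>x. x", symmetric]) auto
  show E0: "expectation X = 0"
    by (rule normal_distributed_expectation[OF assms])
  show "integrable M (\<lambda>\<omega>. (X \<omega>)\<^sup>2)"
    using integrable_normal_moment[OF assms(1), of 0 2]
    by (subst distributed_integrable[OF D, of "\<lambda>x. x\<^sup>2", symmetric]) auto
  show "expectation (\<lambda>\<omega>. (X \<omega>)\<^sup>2) = \<sigma>\<^sup>2"
    using normal_distributed_variance[OF assms] E0 by simp
qed

text \<open>The squared modulus splits into the squares of the real and imaginary parts, each of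
  which contributes v / 2.\<close>

lemma circ_complex_gaussian_moments:
  assumes "circ_complex_gaussian M Z v" "0 < v"
  shows "integrable M Z" "expectation Z = 0"
    "integrable M (\<lambda>\<omega>. (cmod (Z \<omega>))\<^sup>2)" "expectation (\<lambda>\<omega>. (cmod (Z \<omega>))\<^sup>2) = v"
proof -
  have s: "0 < sqrt (v / 2)" using assms(2) by simp
  note R = normal_distributed_second_moment[OF s, of "\<lambda>\<omega>. Re (Z \<omega>)"]
  note I = normal_distributed_second_moment[OF s, of "\<lambda>\<omega>. Im (Z \<omega>)"]
  have D: "distributed M lborel (\<lambda>\<omega>. Re (Z \<omega>)) (normal_density 0 (sqrt (v / 2)))"
    "distributed M lborel (\<lambda>\<omega>. Im (Z \<omega>)) (normal_density 0 (sqrt (v / 2)))"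
    using assms(1) by (auto simp: circ_complex_gaussian_def)
  have Z: "Z = (\<lambda>\<omega>. of_real (Re (Z \<omega>)) + \<i> * of_real (Im (Z \<omega>)))"
    using complex_eq by auto
  show int: "integrable M Z"
    by (subst Z) (intro Bochner_Integration.integrable_add integrable_mult_right integrable_of_real R I D)
  show "expectation Z = 0"
    using R(2)[OF D(1)] I(2)[OF D(2)] int by (simp add: complex_eq_iff)
  show "integrable M (\<lambda>\<omega>. (cmod (Z \<omega>))\<^sup>2)"
    unfolding cmod_power2 by (intro Bochner_Integration.integrable_add R I D)
  show "expectation (\<lambda>\<omega>. (cmod (Z \<omega>))\<^sup>2) = v"
    unfolding cmod_power2 using R(3,4)[OF D(1)] I(3,4)[OF D(2)] assms(2) by simp
qed

text \<open>Conjugation is measurable, so applying it to one factor keeps independence. For centred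
  entries this makes the off-diagonal covariances vanish.\<close>

lemma indep_vars_expectation_mult_cnj:
  fixes Z :: "'i \<Rightarrow> 'a \<Rightarrow> complex"
  assumes ind: "indep_vars (\<lambda>_. borel) Z I" and "i \<in> I" "j \<in> I" "i \<noteq> j"
    and int: "integrable M (Z i)" "integrable M (Z j)"
  shows "integrable M (\<lambda>\<omega>. Z i \<omega> * cnj (Z j \<omega>))"
    and "expectation (\<lambda>\<omega>. Z i \<omega> * cnj (Z j \<omega>)) = expectation (Z i) * cnj (expectation (Z j))"
proof -
  \<comment> \<open>\<open>Y\<close> conjugates the factor with index j alone; the product over
    \<open>{i, j}\<close> in the general independence theorems then becomes
    \<open>Z i \<omega> * cnj (Z j \<omega>)\<close>.\<close>
  define Y where "Y k = (if k = j then cnj else (\<lambda>z. z))" for k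
  have "indep_vars (\<lambda>_. borel) Z {i, j}"
    by (rule indep_vars_subset[OF ind]) (use assms in auto)
  then have "indep_vars (\<lambda>_. borel) (\<lambda>k \<omega>. Y k (Z k \<omega>)) {i, j}"
    by (rule indep_vars_compose2)
      (auto simp: Y_def intro!: borel_measurable_continuous_onI continuous_intros)
  moreover have "integrable M (\<lambda>\<omega>. Y k (Z k \<omega>))" if "k \<in> {i, j}" for k
    using that int assms(4) by (auto simp: Y_def)
  ultimately show "integrable M (\<lambda>\<omega>. Z i \<omega> * cnj (Z j \<omega>))"
    and "expectation (\<lambda>\<omega>. Z i \<omega> * cnj (Z j \<omega>)) = expectation (Z i) * cnj (expectation (Z j))"
    using indep_vars_integrable[of "{i, j}" "\<lambda>k \<omega>. Y k (Z k \<omega>)"]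
      indep_vars_lebesgue_integral[of "{i, j}" "\<lambda>k \<omega>. Y k (Z k \<omega>)"] \<open>i \<noteq> j\<close>
    by (simp_all add: Y_def)
qed

text \<open>When the square is expanded, the terms linear in the noise have mean zero, and the
  quadratic double sum collapses to its diagonal because the family is uncorrelated.\<close>

lemma expectation_cmod_power2_affine:
  fixes Z :: "'i \<Rightarrow> 'a \<Rightarrow> complex" and b :: "'i \<Rightarrow> complex"
  assumes "finite I"
    and int: "\<And>i. i \<in> I \<Longrightarrow> integrable M (Z i)"
    and mean: "\<And>i. i \<in> I \<Longrightarrow> expectation (Z i) = 0"
    and int2: "\<And>i j. i \<in> I \<Longrightarrow> j \<in> I \<Longrightarrow> integrable M (\<lambda>\<omega>. Z i \<omega> * cnj (Z j \<omega>))"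
    and cov: "\<And>i j. i \<in> I \<Longrightarrow> j \<in> I \<Longrightarrow>
      expectation (\<lambda>\<omega>. Z i \<omega> * cnj (Z j \<omega>)) = (if i = j then of_real v else 0)"
  shows "expectation (\<lambda>\<omega>. (cmod (c + (\<Sum>i\<in>I. b i * Z i \<omega>)))\<^sup>2)
    = (cmod c)\<^sup>2 + v * (\<Sum>i\<in>I. (cmod (b i))\<^sup>2)"
proof -
  define S where "S \<omega> = (\<Sum>i\<in>I. b i * Z i \<omega>)" for \<omega>
  have S: "integrable M S" "expectation S = 0"
    unfolding S_def using int mean by (simp_all add: Bochner_Integration.integral_sum)
  have SS: "S \<omega> * cnj (S \<omega>) = (\<Sum>i\<in>I. \<Sum>j\<in>I. b i * cnj (b j) * (Z i \<omega> * cnj (Z j \<omega>)))" for \<omega>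
    by (simp add: S_def sum_product mult_ac)
  have S2: "integrable M (\<lambda>\<omega>. S \<omega> * cnj (S \<omega>))"
    unfolding SS by (intro Bochner_Integration.integrable_sum integrable_mult_right int2)
  have "expectation (\<lambda>\<omega>. S \<omega> * cnj (S \<omega>))
      = (\<Sum>i\<in>I. \<Sum>j\<in>I. b i * cnj (b j) * expectation (\<lambda>\<omega>. Z i \<omega> * cnj (Z j \<omega>)))"
    unfolding SS using int2 by (simp add: Bochner_Integration.integral_sum)
  also have "\<dots> = (\<Sum>i\<in>I. \<Sum>j\<in>I. if i = j then b i * cnj (b j) * of_real v else 0)"
    by (intro sum.cong refl) (simp add: cov)
  also have "\<dots> = of_real (v * (\<Sum>i\<in>I. (cmod (b i))\<^sup>2))"
    using assms(1) by (simp add: complex_norm_square sum_distrib_left mult_ac del: of_real_power)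
  finally have ES2: "expectation (\<lambda>\<omega>. S \<omega> * cnj (S \<omega>)) = of_real (v * (\<Sum>i\<in>I. (cmod (b i))\<^sup>2))" .
  \<comment> \<open>The calculation moves to the complex numbers, where the squared modulus factors
    as z times its conjugate and linearity of the integral applies; injectivity of
    \<open>of_real\<close> brings the result back.\<close>
  have "complex_of_real (expectation (\<lambda>\<omega>. (cmod (c + S \<omega>))\<^sup>2))
      = expectation (\<lambda>\<omega>. of_real ((cmod (c + S \<omega>))\<^sup>2))"
    by (rule integral_complex_of_real[symmetric])
  also have "\<dots> = expectation (\<lambda>\<omega>. c * cnj c + c * cnj (S \<omega>) + S \<omega> * cnj c + S \<omega> * cnj (S \<omega>))"
    by (simp add: complex_norm_square algebra_simps del: of_real_power)
  also have "\<dots> = c * cnj c + of_real (v * (\<Sum>i\<in>I. (cmod (b i))\<^sup>2))"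
    using S S2 ES2 by (simp add: prob_space)
  also have "\<dots> = of_real ((cmod c)\<^sup>2 + v * (\<Sum>i\<in>I. (cmod (b i))\<^sup>2))"
    by (simp add: complex_norm_square del: of_real_power)
  finally show ?thesis
    unfolding S_def using of_real_eq_iff by blast
qed

text \<open>The offset c stays free because two values are needed: with p =
  \<open>herm_prod f x\<close>, the estimation error has offset h (p - 1) and the estimate itself
  has offset h p.\<close>

lemma expectation_herm_prod_gaussian:
  fixes W :: "'a \<Rightarrow> complex ^ 'n"
  assumes W: "iid_circ_complex_gaussian M W v" and v: "0 < v"
  shows "expectation (\<lambda>\<omega>. (cmod (c + herm_prod f (W \<omega>)))\<^sup>2) = (cmod c)\<^sup>2 + v * (norm f)\<^sup>2"
proof -
  have ind: "indep_vars (\<lambda>_. borel) (\<lambda>i \<omega>. W \<omega> $ i) UNIV"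
    and G: "\<And>i. circ_complex_gaussian M (\<lambda>\<omega>. W \<omega> $ i) v"
    using W by (auto simp: iid_circ_complex_gaussian_def)
  note m = circ_complex_gaussian_moments[OF G v]
  have sq: "W \<omega> $ i * cnj (W \<omega> $ i) = of_real ((cmod (W \<omega> $ i))\<^sup>2)" for \<omega> i
    by (simp only: complex_norm_square)
  have cov: "integrable M (\<lambda>\<omega>. W \<omega> $ i * cnj (W \<omega> $ j)) \<and>
      expectation (\<lambda>\<omega>. W \<omega> $ i * cnj (W \<omega> $ j)) = (if i = j then of_real v else 0)" for i j
  proof (cases "i = j")
    case True
    then show ?thesis
      using m(3,4)[of i] by (simp add: sq integrable_of_real del: of_real_power)
  next
    case False
    then show ?thesis
      using indep_vars_expectation_mult_cnj[OF ind UNIV_I UNIV_I False m(1) m(1)] m(2) by simp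
  qed
  show ?thesis
    unfolding herm_prod_def
    using expectation_cmod_power2_affine[of UNIV "\<lambda>i \<omega>. W \<omega> $ i" v c "\<lambda>i. cnj (f $ i)"] m(1,2) cov
    by (simp add: norm_vec_power2)
qed

lemma mse_dc_zf_0_eq:
  fixes W :: "'a \<Rightarrow> complex ^ 'n"
  assumes W: "iid_circ_complex_gaussian M W (\<sigma>w\<^sup>2)" and "0 < \<sigma>w"
  shows "mse_dc_zf_0 M W \<sigma>x \<sigma>w h x f =
    (((cmod h)\<^sup>2 * (cmod (herm_prod f x - 1))\<^sup>2 + \<sigma>w\<^sup>2 * (norm f)\<^sup>2) * \<sigma>x\<^sup>2 + \<sigma>w\<^sup>2)
      / ((cmod h)\<^sup>2 * (cmod (herm_prod f x))\<^sup>2 + \<sigma>w\<^sup>2 * (norm f)\<^sup>2)"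
proof -
  have *: "channel_estimate h x W f \<omega> = h * herm_prod f x + herm_prod f (W \<omega>)" for \<omega>
    by (simp add: channel_estimate_def training_output_def herm_prod_add_right herm_prod_mult_right)
  have **: "channel_estimate h x W f \<omega> - h = h * (herm_prod f x - 1) + herm_prod f (W \<omega>)" for \<omega>
    by (simp add: * algebra_simps)
  have v: "0 < \<sigma>w\<^sup>2" using assms(2) by simp
  show ?thesis
    \<comment> \<open>The error is rewritten first, since rewriting the estimate would destroy the
      pattern of \<open>**\<close>.\<close>
    unfolding mse_dc_zf_0_def ** unfolding *
    by (simp only: expectation_herm_prod_gaussian[OF W v] norm_mult power_mult_distrib)
      (simp add: add_divide_distrib distrib_right)
qed

end

text \<open>The completed square as an exact identity. The two terms in the bracket stay apart
  because each is nonnegative for its own reason: the first measures the distance of p from c, the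
  second is the slack in Cauchy-Schwarz.\<close>

lemma zf_mse_excess:
  fixes p :: complex and a c D K N S v :: real
  assumes "D > 0" "S > 0" "K > 0" "c > 0" and "v = S * a * (c - 1)"
    and "N = D + a * (1 - 2 * Re p)"
  shows "(N * S + v) / D - S * (1 - a / (K * c))
    = S * a * (K * (cmod (p - of_real c))\<^sup>2 + (D - K * (cmod p)\<^sup>2)) / (D * K * c)"
proof -
  have 1: "(cmod (p - of_real c))\<^sup>2 = (cmod p)\<^sup>2 - 2 * c * Re p + c\<^sup>2"
    unfolding cmod_power2 by (simp add: power2_eq_square algebra_simps)
  show ?thesis
    unfolding 1 assms(5,6) using assms(1-4) by (simp add: field_simps power2_eq_square)
qed

theorem mainTheorem2:
  fixes M :: "'a measure"
    and w :: "'a \<Rightarrow> complex ^ 'n"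
    and x :: "complex ^ 'n"
    and h :: complex
    and \<sigma>x \<sigma>w :: real
  assumes "prob_space M"
    and "\<sigma>x > 0" and "\<sigma>w > 0"
    and "iid_circ_complex_gaussian M w (\<sigma>w\<^sup>2)"
    and "x \<noteq> 0" and "h \<noteq> 0"
  shows "(\<forall>f. is_arg_min (mse_dc_zf_0 M w \<sigma>x \<sigma>w h x) (\<lambda>f. f \<noteq> 0) f \<longrightarrow>
            herm_prod f x = of_real (1 + \<sigma>w\<^sup>2 / (\<sigma>x\<^sup>2 * (cmod h)\<^sup>2)))
       \<and> herm_prod (f_opt_dc_zf \<sigma>x \<sigma>w h x) x = of_real (1 + \<sigma>w\<^sup>2 / (\<sigma>x\<^sup>2 * (cmod h)\<^sup>2))
       \<and> is_arg_min (mse_dc_zf_0 M w \<sigma>x \<sigma>w h x) (\<lambda>f. f \<noteq> 0) (f_opt_dc_zf \<sigma>x \<sigma>w h x)"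
proof -
  interpret prob_space M by fact
  define a where "a = (cmod h)\<^sup>2"
  define c where "c = 1 + \<sigma>w\<^sup>2 / (\<sigma>x\<^sup>2 * a)"
  define K where "K = a + \<sigma>w\<^sup>2 / (norm x)\<^sup>2"
  define D where "D f = a * (cmod (herm_prod f x))\<^sup>2 + \<sigma>w\<^sup>2 * (norm f)\<^sup>2" for f
  let ?mse = "mse_dc_zf_0 M w \<sigma>x \<sigma>w h x" and ?fo = "f_opt_dc_zf \<sigma>x \<sigma>w h x"
  \<comment> \<open>The candidate minimum: p = c and D = K c^2 turn a (c - 2 Re p) / D into - a / (K
    c).\<close>
  define m where "m = \<sigma>x\<^sup>2 * (1 - a / (K * c))"
  have a: "a > 0" using assms by (simp add: a_def)
  have c: "c > 0" unfolding c_def using a assms by (simp add: add_pos_nonneg)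
  have K: "K > 0" unfolding K_def using a by (simp add: add_pos_nonneg)
  \<comment> \<open>The noise term keeps the denominator positive even when
    \<open>herm_prod f x\<close> is 0, so every division below is genuine.\<close>
  have D: "D f > 0" if "f \<noteq> 0" for f
    unfolding D_def using that a assms by (simp add: add_nonneg_pos)
  have mse: "?mse f - m = \<sigma>x\<^sup>2 * a * (K * (cmod (herm_prod f x - of_real c))\<^sup>2
      + (D f - K * (cmod (herm_prod f x))\<^sup>2)) / (D f * K * c)" if "f \<noteq> 0" for f
  proof -
    \<comment> \<open>This relation characterizes c; it absorbs the additive noise term of the
      numerator into the factor a (c - 2 Re p).\<close>
    have v: "\<sigma>w\<^sup>2 = \<sigma>x\<^sup>2 * a * (c - 1)"
      using a assms by (simp add: c_def)
    have N: "a * (cmod (herm_prod f x - 1))\<^sup>2 + \<sigma>w\<^sup>2 * (norm f)\<^sup>2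
        = D f + a * (1 - 2 * Re (herm_prod f x))"
      unfolding D_def cmod_power2[of "herm_prod f x"] cmod_power2[of "herm_prod f x - 1"]
      by (simp add: power2_eq_square algebra_simps)
    have "0 < \<sigma>x\<^sup>2" using assms(2) by simp
    from zf_mse_excess[OF D[OF that] this K c v N] show ?thesis
      unfolding m_def mse_dc_zf_0_eq[OF assms(4,3)] D_def a_def .
  qed
  have DK: "K * (cmod (herm_prod f x))\<^sup>2 \<le> D f" for f
  proof -
    have "(cmod (herm_prod f x))\<^sup>2 \<le> (norm f)\<^sup>2 * (norm x)\<^sup>2"
      using power_mono[OF cmod_herm_prod_le[of f x], of 2] by (simp add: power_mult_distrib)
    then have "(cmod (herm_prod f x))\<^sup>2 / (norm x)\<^sup>2 \<le> (norm f)\<^sup>2"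
      using assms(5) by (simp add: divide_le_eq)
    then have "\<sigma>w\<^sup>2 * ((cmod (herm_prod f x))\<^sup>2 / (norm x)\<^sup>2) \<le> \<sigma>w\<^sup>2 * (norm f)\<^sup>2"
      by (rule mult_left_mono) simp
    then show ?thesis by (simp add: K_def D_def algebra_simps)
  qed
  have lower: "m \<le> ?mse f" if "f \<noteq> 0" for f
  proof -
    have "0 \<le> ?mse f - m"
      unfolding mse[OF that] using a c K D[OF that] DK[of f] by simp
    then show ?thesis by simp
  qed
  \<comment> \<open>The assumption is a bound by \<open>m\<close> rather than minimality. Once
    \<open>?fo\<close> is known to reach \<open>m\<close>, every minimizer satisfies this
    bound.\<close>
  have attained: "herm_prod f x = of_real c" if "f \<noteq> 0" "?mse f \<le> m" for f
  proof -
    have "?mse f - m = 0"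
      using lower[OF that(1)] that(2) by simp
    \<comment> \<open>The prefactor and the denominator are positive, so the bracket vanishes; being
      a sum of nonnegative terms, it forces the square to vanish.\<close>
    then have "K * (cmod (herm_prod f x - of_real c))\<^sup>2 + (D f - K * (cmod (herm_prod f x))\<^sup>2) = 0"
      unfolding mse[OF that(1)] using a c K D[OF that(1)] assms(2) by simp
    moreover have "0 \<le> K * (cmod (herm_prod f x - of_real c))\<^sup>2"
      using K by simp
    ultimately have "K * (cmod (herm_prod f x - of_real c))\<^sup>2 = 0"
      using DK[of f] by linarith
    then show ?thesis using K by simp
  qed
  have fo: "?fo = (c / (norm x)\<^sup>2) *\<^sub>R x"
    by (simp add: f_opt_dc_zf_def c_def a_def)
  have fo0: "?fo \<noteq> 0"
    using c assms(5) by (simp add: fo)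
  have pfo: "herm_prod ?fo x = of_real c"
    using assms(5) by (simp add: fo herm_prod_scaleR_left herm_prod_self)
  \<comment> \<open>As \<open>?fo\<close> is parallel to \<open>x\<close>, Cauchy-Schwarz is an
    equality here: D equals K c^2, and both terms of the excess are zero.\<close>
  have "(norm ?fo)\<^sup>2 = c\<^sup>2 / (norm x)\<^sup>2"
    using assms(5) by (simp add: fo power_mult_distrib power_divide power2_eq_square)
  then have "D ?fo = K * c\<^sup>2"
    by (simp add: D_def K_def pfo algebra_simps)
  then have "?mse ?fo = m"
    using mse[OF fo0] by (simp add: pfo)
  then have "is_arg_min ?mse (\<lambda>f. f \<noteq> 0) ?fo"
    "is_arg_min ?mse (\<lambda>f. f \<noteq> 0) f \<Longrightarrow> herm_prod f x = of_real c" for f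
    using lower attained fo0 by (auto simp: is_arg_min_linorder)
  then show ?thesis
    using pfo unfolding c_def a_def by blast
qed

end
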